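(* Let $(\mathsf{X},\varrho)$ be a complete separable metric space with Borel $\sigma$-algebra $\mathcal{B}$, where $\varrho$ is bounded, and let $P$ be a Markov transition kernel on $(\mathsf{X},\mathcal{B})$. Suppose the following two conditions hold. (C1) There exist a measurable function $\bar V:\mathsf{X}\to[1,\infty)$, $\eta'\in[0,1)$ and $L'\in\mathbb{R}$ such that $P\bar V(x)\le\eta'\bar V(x)+L'$ for all $x\in\mathsf{X}$. (C2) There exist $\gamma'\in[0,1)$ and $\delta'>0$ such that, with $C'=\{(x,y)\in\mathsf{X}\times\mathsf{X}:\bar V(x)+\bar V(y)\le(2L'+\delta')/(1-\eta')\}$, one has $W_\varrho(\delta_xP,\delta_yP)\le\gamma'\varrho(x,y)$ for $(x,y)\in C'$ and $W_\varrho(\delta_xP,\delta_yP)\le\varrho(x,y)$ for $(x,y)\notin C'$. Let $$\rho^{\mathrm{DM}}=\exp\left(-\frac{\log(1/\lambda)\log(1/\gamma')}{\log J+\log(1/\gamma')}\right),\qquad \lambda=\frac{2L'(1-\eta')}{2L'+\delta'}+\eta',\qquad J=\frac{2L'+\delta'}{1-\eta'}+\frac{2L'}{\lambda}.$$ Then there exist a measurable function $V:\mathsf{X}\to[0,\infty)$ and constants $a,L,K\in[0,\infty)$, $\eta,\gamma\in[0,1)$, $d>2L/(1-\eta)$ such that conditions (A1), (A2), (A3) of the context hold with $\psi=\varrho$, and there exists a real number $r$ satisfying $$\frac{\log(2L+1)}{\log(2L+1)+\log(1/\gamma)}<r<\frac{\log[(d+1)/(\eta d+2L+1)]}{\log(K\vee1)+\log[(d+1)/(\eta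 d+2L+1)]}$$ such that $$\rho_r:=\left[\gamma^r(2L+1)^{1-r}\right]\vee\left[K^r\left(\frac{\eta d+2L+1}{d+1}\right)^{1-r}\right]<\rho^{\mathrm{DM}}.$$
   Context: For $\mu,\nu\in\mathcal{P}(\mathsf{X})$ (probability measures on $(\mathsf{X},\mathcal{B})$), $W_\varrho(\mu,\nu)=\inf_\upsilon\int\varrho(x,y)\,\upsilon(dx,dy)$, the infimum being over all couplings $\upsilon$ of $\mu$ and $\nu$. $\delta_x$ is the point mass at $x$, $\delta_xP=P(x,\cdot)$, and $PV(x)=\int V(y)P(x,dy)$. $s\vee t=\max(s,t)$. The conditions, with $\psi=\varrho$: (A1) $\psi(x,y)\le a[V(x)+V(y)+1]$ for all $(x,y)\in\mathsf{X}\times\mathsf{X}$, and $PV(x)\le\eta V(x)+L$ for all $x\in\mathsf{X}$. (A2) With $C=\{(x,y)\in\mathsf{X}\times\mathsf{X}:V(x)+V(y)<d\}$, one has $W_\psi(\delta_xP,\delta_yP)\le\gamma\psi(x,y)$ for $(x,y)\in C$ and $W_\psi(\delta_xP,\delta_yP)\le K\psi(x,y)$ for $(x,y)\notin C$. (A3) Either $K\le1$ or $\log K\,\log(2L+1)<\log\frac1\gamma\,\log\frac{d+1}{\eta d+2L+1}$. (Under (A1)-(A3), $\rho_r$ is an upper bound on the geometric rate of convergence of $P$ in $W_\psi$ to its stationary distribution; $\rho^{\mathrm{DM}}$ is the rate bound of Durmus and Moulines under (C1)-(C2).) Convention: if $\gamma=0$ or $\gamma'=0$, the expressions involving $\log(1/\gamma)$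 or $\log(1/\gamma')$ are read with $\log(1/0)=+\infty$; thus the lower bound for $r$ is $0$ when $\gamma=0$, the inequality in (A3) holds automatically when $\gamma=0$, and $\rho^{\mathrm{DM}}=\lambda$ when $\gamma'=0$. *)

theory Defs
  imports "HOL-Probability.Probability"
begin

definition couplings :: "'a::topological_space measure \<Rightarrow> 'a measure \<Rightarrow> ('a \<times> 'a) measure set" where
  "couplings \<mu> \<nu> = {\<upsilon>. prob_space \<upsilon> \<and> sets \<upsilon> = sets (borel \<Otimes>\<^sub>M borel) \<and>
     distr \<upsilon> borel fst = \<mu> \<and> distr \<upsilon> borel snd = \<nu>}"

definition wasserstein ::
    "('a \<Rightarrow> 'a \<Rightarrow> real) \<Rightarrow> 'a::topological_space measure \<Rightarrow> 'a measure \<Rightarrow> ennreal" where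
  "wasserstein \<psi> \<mu> \<nu> =
     (INF \<upsilon>\<in>couplings \<mu> \<nu>. \<integral>\<^sup>+ z. ennreal (\<psi> (fst z) (snd z)) \<partial>\<upsilon>)"

text \<open>The value \<open>PV(x)\<close>, for nonnegative \<open>V\<close>; it may be infinite.\<close>
definition kernel_app :: "('a \<Rightarrow> 'a measure) \<Rightarrow> ('a \<Rightarrow> real) \<Rightarrow> 'a \<Rightarrow> ennreal" where
  "kernel_app P V x = (\<integral>\<^sup>+ y. ennreal (V y) \<partial>P x)"

text \<open>A negative right-hand side is truncated to 0 by \<open>ennreal\<close>. This is harmless where \<open>L\<close> is
  an arbitrary real: there \<open>V \<ge> 1\<close> and each \<open>P x\<close> is a probability measure, so \<open>PV \<ge> 1\<close> and
  the truncated inequality fails exactly as the original one does.\<close>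
definition drift :: "('a \<Rightarrow> 'a measure) \<Rightarrow> ('a \<Rightarrow> real) \<Rightarrow> real \<Rightarrow> real \<Rightarrow> bool" where
  "drift P V \<eta> L \<longleftrightarrow> (\<forall>x. kernel_app P V x \<le> ennreal (\<eta> * V x + L))"

definition contracts_on ::
    "('a \<Rightarrow> 'a \<Rightarrow> real) \<Rightarrow> ('a::topological_space \<Rightarrow> 'a measure) \<Rightarrow> real \<Rightarrow> ('a \<times> 'a) set \<Rightarrow> bool" where
  "contracts_on \<psi> P c S \<longleftrightarrow>
     (\<forall>(x, y)\<in>S. wasserstein \<psi> (P x) (P y) \<le> ennreal (c * \<psi> x y))"

definition cond_A1 ::
    "('a \<Rightarrow> 'a \<Rightarrow> real) \<Rightarrow> ('a \<Rightarrow> 'a measure) \<Rightarrow> ('a \<Rightarrow> real) \<Rightarrow> real \<Rightarrow> real \<Rightarrow> real \<Rightarrow> bool" where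
  "cond_A1 \<psi> P V a \<eta> L \<longleftrightarrow> (\<forall>x y. \<psi> x y \<le> a * (V x + V y + 1)) \<and> drift P V \<eta> L"

definition cond_A2 ::
    "('a \<Rightarrow> 'a \<Rightarrow> real) \<Rightarrow> ('a::topological_space \<Rightarrow> 'a measure) \<Rightarrow> ('a \<Rightarrow> real) \<Rightarrow>
     real \<Rightarrow> real \<Rightarrow> real \<Rightarrow> bool" where
  "cond_A2 \<psi> P V d \<gamma> K \<longleftrightarrow>
     (let C = {(x, y). V x + V y < d} in contracts_on \<psi> P \<gamma> C \<and> contracts_on \<psi> P K (- C))"

text \<open>Since \<open>ln (1 / 0) = 0\<close> in HOL, the convention \<open>log (1 / 0) = \<infinity>\<close> is made explicit by
  treating \<open>\<gamma> = 0\<close> separately here and in \<open>r_lower\<close> and \<open>rho_DM\<close>.\<close>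
definition cond_A3 :: "real \<Rightarrow> real \<Rightarrow> real \<Rightarrow> real \<Rightarrow> real \<Rightarrow> bool" where
  "cond_A3 \<eta> L d \<gamma> K \<longleftrightarrow> K \<le> 1 \<or> \<gamma> = 0 \<or>
     ln K * ln (2 * L + 1) < ln (1 / \<gamma>) * ln ((d + 1) / (\<eta> * d + 2 * L + 1))"

definition r_lower :: "real \<Rightarrow> real \<Rightarrow> real" where
  "r_lower L \<gamma> = (if \<gamma> = 0 then 0 else ln (2 * L + 1) / (ln (2 * L + 1) + ln (1 / \<gamma>)))"

definition r_upper :: "real \<Rightarrow> real \<Rightarrow> real \<Rightarrow> real \<Rightarrow> real" where
  "r_upper \<eta> L d K = ln ((d + 1) / (\<eta> * d + 2 * L + 1)) /
     (ln (max K 1) + ln ((d + 1) / (\<eta> * d + 2 * L + 1)))"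

text \<open>Used only for \<open>r > 0\<close>, where \<open>0 powr r = 0\<close> is the intended value of \<open>0\<^sup>r\<close>.\<close>
definition rho :: "real \<Rightarrow> real \<Rightarrow> real \<Rightarrow> real \<Rightarrow> real \<Rightarrow> real \<Rightarrow> real" where
  "rho \<eta> L d \<gamma> K r =
     max (\<gamma> powr r * (2 * L + 1) powr (1 - r))
         (K powr r * ((\<eta> * d + 2 * L + 1) / (d + 1)) powr (1 - r))"

definition cond_C1 :: "('a::topological_space \<Rightarrow> 'a measure) \<Rightarrow> ('a \<Rightarrow> real) \<Rightarrow> real \<Rightarrow> real \<Rightarrow> bool" where
  "cond_C1 P V \<eta> L \<longleftrightarrow>
     V \<in> borel_measurable borel \<and> (\<forall>x. 1 \<le> V x) \<and> 0 \<le> \<eta> \<and> \<eta> < 1 \<and> drift P V \<eta> L"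

definition cond_C2 ::
    "('a::metric_space \<Rightarrow> 'a measure) \<Rightarrow> ('a \<Rightarrow> real) \<Rightarrow> real \<Rightarrow> real \<Rightarrow> real \<Rightarrow> real \<Rightarrow> bool" where
  "cond_C2 P V \<eta> L \<gamma> \<delta> \<longleftrightarrow> 0 \<le> \<gamma> \<and> \<gamma> < 1 \<and> 0 < \<delta> \<and>
     (let C = {(x, y). V x + V y \<le> (2 * L + \<delta>) / (1 - \<eta>)}
      in contracts_on dist P \<gamma> C \<and> contracts_on dist P 1 (- C))"

definition lambda_DM :: "real \<Rightarrow> real \<Rightarrow> real \<Rightarrow> real" where
  "lambda_DM \<eta> L \<delta> = 2 * L * (1 - \<eta>) / (2 * L + \<delta>) + \<eta>"

definition J_DM :: "real \<Rightarrow> real \<Rightarrow> real \<Rightarrow> real" where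
  "J_DM \<eta> L \<delta> = (2 * L + \<delta>) / (1 - \<eta>) + 2 * L / lambda_DM \<eta> L \<delta>"

definition rho_DM :: "real \<Rightarrow> real \<Rightarrow> real \<Rightarrow> real \<Rightarrow> real" where
  "rho_DM \<eta> L \<gamma> \<delta> =
     (if \<gamma> = 0 then lambda_DM \<eta> L \<delta>
      else exp (- (ln (1 / lambda_DM \<eta> L \<delta>) * ln (1 / \<gamma>) /
                   (ln (J_DM \<eta> L \<delta>) + ln (1 / \<gamma>)))))"

end

theory Submission
  imports Defs
begin

text \<open>With \<open>V = c (Vbar - 1)\<close> the conditions (C1), (C2) turn into (A1), (A2) with \<open>K = 1\<close>,
  so (A3) is trivial and the upper bound for \<open>r\<close> is 1. For \<open>c = 1/2\<close> the ratio
  \<open>(\<eta> d + 2 L + 1) / (d + 1)\<close> is exactly \<open>\<lambda>\<close> and \<open>2 L + 1 = L' + \<eta>'\<close>, so the \<open>r\<close> that balances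
  the two terms of \<open>\<rho>\<^sub>r\<close> gives the formula for \<open>\<rho>\<^sup>D\<^sup>M\<close> with \<open>J\<close> replaced by
  \<open>(L' + \<eta>') / \<lambda> < J\<close>. If \<open>\<gamma>' = 0\<close> this only yields \<open>\<rho>\<^sub>r > \<lambda>\<close>, but then \<open>c = 1\<close> makes the
  ratio smaller than \<open>\<lambda>\<close>, and a small \<open>r\<close> suffices.\<close>

lemma kernel_prob_space:
  assumes "P \<in> borel \<rightarrow>\<^sub>M prob_algebra borel"
  shows "prob_space (P x)" "sets (P x) = sets borel"
  using measurable_space[OF assms, of x] by (auto simp: space_prob_algebra)

text \<open>Integrating the constant \<open>m\<close> against the probability measure
  \<open>P x\<close> bounds \<open>PV(x)\<close> from below. Since \<open>m\<close> is positive, the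
  right-hand side cannot have been truncated to 0.\<close>

lemma drift_lower_bound:
  assumes "prob_space (P x)" and "drift P V \<eta> L" and "\<And>y. m \<le> V y" and "0 < m"
  shows "m \<le> \<eta> * V x + L"
proof -
  interpret prob_space "P x" by fact
  have "ennreal m = (\<integral>\<^sup>+ y. ennreal m \<partial>P x)"
    by (simp add: emeasure_space_1)
  also have "\<dots> \<le> kernel_app P V x"
    unfolding kernel_app_def by (intro nn_integral_mono ennreal_leI assms)
  also have "\<dots> \<le> ennreal (\<eta> * V x + L)"
    using assms(2) by (simp add: drift_def)
  finally show ?thesis
    using assms(4) by (metis ennreal_le_iff2 not_less)
qed

text \<open>Passing to the infimum \<open>m\<close> of \<open>V\<close> in the drift inequality
  gives \<open>m \<le> \<eta> * m + L\<close>, hence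
  \<open>L \<ge> (1 - \<eta>) * m \<ge> 1 - \<eta>\<close>. This makes the rescaled drift constant
  \<open>c * (L + \<eta> - 1)\<close> nonnegative.\<close>

lemma drift_const_lower_bound:
  assumes "\<And>x. prob_space (P x)" and "drift P V \<eta> L" and V1: "\<And>y. 1 \<le> V y"
    and "0 \<le> \<eta>" "\<eta> < 1"
  shows "1 - \<eta> \<le> L"
proof -
  define m where "m = (INF x. V x)"
  have bdd: "bdd_below (range V)"
    using V1 by (auto intro!: bdd_belowI[of _ 1])
  have mV: "m \<le> V x" for x
    unfolding m_def using bdd by (simp add: cINF_lower)
  have m1: "1 \<le> m"
    unfolding m_def using V1 by (intro cINF_greatest) auto
  have "m \<le> \<eta> * m + L"
  proof (rule ccontr)
    assume "\<not> m \<le> \<eta> * m + L"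
    \<comment> \<open>The infimum may not be attained, so a point with \<open>V x - m\<close> below
      the gap \<open>m - \<eta> * m - L\<close> is taken; the drift bounds that gap by
      \<open>\<eta> * (V x - m)\<close>.\<close>
    then have "m < m + (m - \<eta> * m - L)" by simp
    then obtain x where x: "V x < m + (m - \<eta> * m - L)"
      unfolding m_def using cINF_less_iff[OF _ bdd] by auto
    have "m \<le> \<eta> * V x + L"
      using assms mV m1 by (intro drift_lower_bound[of P]) auto
    moreover have "\<eta> * (V x - m) \<le> 1 * (V x - m)"
      using mV[of x] assms by (intro mult_right_mono) auto
    ultimately show False using x by (simp add: algebra_simps)
  qed
  moreover have "(1 - \<eta>) * 1 \<le> (1 - \<eta>) * m"
    using m1 assms by (intro mult_left_mono) auto
  ultimately show ?thesis by (simp add: algebra_simps)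
qed

text \<open>As \<open>P x\<close> has mass 1, subtracting 1 from \<open>V\<close> subtracts 1 from
  \<open>PV\<close>, and
  \<open>\<eta> * V x + L - 1 = \<eta> * (V x - 1) + (L + \<eta> - 1)\<close>.\<close>

lemma drift_affine:
  assumes prob: "\<And>x. prob_space (P x)" and meas: "\<And>x. V \<in> borel_measurable (P x)"
    and drift: "drift P V \<eta> L" and V1: "\<And>y. 1 \<le> V y" and "0 \<le> c"
  shows "drift P (\<lambda>x. c * (V x - 1)) \<eta> (c * (L + \<eta> - 1))"
  unfolding drift_def
proof
  fix x
  interpret prob_space "P x" by (rule prob)
  have [measurable]: "V \<in> borel_measurable (P x)" by (rule meas)
  let ?I = "\<integral>\<^sup>+ y. ennreal (V y - 1) \<partial>P x"
  have ge: "1 \<le> \<eta> * V x + L"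
    using prob drift V1 by (intro drift_lower_bound[of P]) auto
  \<comment> \<open>The 1 is added to both sides and cancelled at the end, which avoids truncated
    subtraction in \<open>ennreal\<close>.\<close>
  have "?I + 1 = (\<integral>\<^sup>+ y. ennreal (V y - 1) + 1 \<partial>P x)"
    by (subst nn_integral_add) (auto simp: emeasure_space_1)
  also have "\<dots> = kernel_app P V x"
    unfolding kernel_app_def using V1
    by (intro nn_integral_cong) (simp flip: ennreal_1 ennreal_plus)
  also have "\<dots> \<le> ennreal (\<eta> * V x + L)"
    using drift by (simp add: drift_def)
  also have "\<dots> = ennreal (\<eta> * V x + L - 1) + 1"
    using ge by (simp flip: ennreal_1 ennreal_plus)
  finally have I: "?I \<le> ennreal (\<eta> * V x + L - 1)"
    by (simp add: ennreal_add_left_cancel_le add.commute)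
  have "kernel_app P (\<lambda>x. c * (V x - 1)) x = ennreal c * ?I"
    unfolding kernel_app_def using V1 \<open>0 \<le> c\<close>
    by (simp add: ennreal_mult nn_integral_cmult)
  also have "\<dots> \<le> ennreal c * ennreal (\<eta> * V x + L - 1)"
    using I by (rule mult_left_mono) simp
  also have "\<dots> = ennreal (\<eta> * (c * (V x - 1)) + c * (L + \<eta> - 1))"
    using \<open>0 \<le> c\<close> ge by (simp add: algebra_simps flip: ennreal_mult)
  finally show "kernel_app P (\<lambda>x. c * (V x - 1)) x
      \<le> ennreal (\<eta> * (c * (V x - 1)) + c * (L + \<eta> - 1))" .
qed

lemma contracts_on_mono:
  assumes "contracts_on \<psi> P c S" "c \<le> c'" "T \<subseteq> S" "\<And>x y. 0 \<le> \<psi> x y"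
  shows "contracts_on \<psi> P c' T"
  unfolding contracts_on_def
proof clarify
  fix x y assume "(x, y) \<in> T"
  then have "wasserstein \<psi> (P x) (P y) \<le> ennreal (c * \<psi> x y)"
    using assms by (auto simp: contracts_on_def)
  also have "\<dots> \<le> ennreal (c' * \<psi> x y)"
    using assms by (intro ennreal_leI mult_right_mono) auto
  finally show "wasserstein \<psi> (P x) (P y) \<le> ennreal (c' * \<psi> x y)" .
qed

lemma contracts_on_Un:
  "contracts_on \<psi> P c (S \<union> T) \<longleftrightarrow> contracts_on \<psi> P c S \<and> contracts_on \<psi> P c T"
  by (auto simp: contracts_on_def)

lemma cond_A2_affine:
  assumes C2: "cond_C2 P V \<eta> L \<gamma> \<delta>" and "0 < c"
  shows "cond_A2 dist P (\<lambda>x. c * (V x - 1)) (c * ((2 * L + \<delta>) / (1 - \<eta>) - 2)) \<gamma> 1"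
proof -
  define D where "D = (2 * L + \<delta>) / (1 - \<eta>)"
  define C' where "C' = {(x, y). V x + V y \<le> D}"
  define C where "C = {(x, y). c * (V x - 1) + c * (V y - 1) < c * (D - 2)}"
  have \<gamma>: "\<gamma> < 1" and c1: "contracts_on dist P \<gamma> C'" and c2: "contracts_on dist P 1 (- C')"
    using C2 by (simp_all add: cond_C2_def Let_def D_def C'_def)
  have C_iff: "(x, y) \<in> C \<longleftrightarrow> V x + V y < D" for x y
  proof -
    have "(x, y) \<in> C \<longleftrightarrow> c * (V x + V y - 2) < c * (D - 2)"
      by (simp add: C_def algebra_simps)
    then show ?thesis using \<open>0 < c\<close> by simp
  qed
  \<comment> \<open>\<open>C\<close> is \<open>C'\<close> without the pairs where
    \<open>V x + V y = D\<close>. These fall into \<open>- C\<close>, where their constant \<gamma>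
    is weakened to 1.\<close>
  have "contracts_on dist P 1 (C' \<union> - C')"
    using contracts_on_mono[OF c1, of 1 C'] c2 \<gamma> by (simp only: contracts_on_Un) simp
  then have "contracts_on dist P 1 (- C)"
    by (rule contracts_on_mono) auto
  moreover have "contracts_on dist P \<gamma> C"
    using c1 by (rule contracts_on_mono) (auto simp: C_iff C'_def)
  ultimately show ?thesis
    by (simp add: cond_A2_def Let_def C_def D_def)
qed

lemma rho_one_lt_rho_DM:
  fixes \<eta> L \<delta> \<gamma> :: real
  defines "D \<equiv> (2 * L + \<delta>) / (1 - \<eta>)"
  assumes "0 \<le> \<eta>" "\<eta> < 1" "1 - \<eta> \<le> L" "0 < \<delta>" "0 \<le> \<gamma>" "\<gamma> < 1"
  shows "\<exists>c r. 0 < c \<and> r_lower (c * (L + \<eta> - 1)) \<gamma> < r \<and>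
    r < r_upper \<eta> (c * (L + \<eta> - 1)) (c * (D - 2)) 1 \<and>
    rho \<eta> (c * (L + \<eta> - 1)) (c * (D - 2)) \<gamma> 1 r < rho_DM \<eta> L \<gamma> \<delta>"
proof -
  define l where "l = lambda_DM \<eta> L \<delta>"
  have "0 < L" using assms by simp
  have D2: "2 < D"
    using assms by (simp add: D_def field_simps)
  have lD: "l * D = \<eta> * D + 2 * L"
  proof -
    have "l = 2 * L / D + \<eta>" by (simp add: l_def lambda_DM_def D_def)
    then show ?thesis using D2 by (simp add: field_simps)
  qed
  \<comment> \<open>The difference of the two sides is \<delta>; this is what forces
    \<open>l < 1\<close>.\<close>
  have "2 * L < (1 - \<eta>) * D"
    using assms by (simp add: D_def)
  then have "l * D < 1 * D"
    unfolding lD by (simp add: algebra_simps)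
  then have l1: "l < 1" using D2 by simp
  have "0 < \<eta> * D + 2 * L"
    using assms D2 \<open>0 < L\<close> by (intro add_nonneg_pos) auto
  then have l0: "0 < l"
    using D2 by (metis lD zero_less_mult_pos2 less_trans zero_less_numeral)
  show ?thesis
  proof (cases "\<gamma> = 0")
    case True
    \<comment> \<open>The ratio for \<open>c = 1\<close>: subtracting 1 from numerator and
      denominator of \<open>l = l * D / D < 1\<close> lowers the fraction.\<close>
    define q where "q = (l * D - 1) / (D - 1)"
    have "1 < l * D" unfolding lD using assms D2
      mult_left_mono[of 2 D \<eta>] by auto
    then have q0: "0 < q" using D2 by (simp add: q_def)
    have ql: "q < l" using l1 D2 by (simp add: q_def field_simps)
    have ratio: "(\<eta> * (1 * (D - 2)) + 2 * (1 * (L + \<eta> - 1)) + 1) / (1 * (D - 2) + 1) = q"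
      unfolding q_def lD by (rule arg_cong2[where f = "(/)"]) (simp_all add: algebra_simps)
    have inv: "(1 * (D - 2) + 1) / (\<eta> * (1 * (D - 2)) + 2 * (1 * (L + \<eta> - 1)) + 1) = 1 / q"
      unfolding ratio[symmetric] by simp
    have "((\<lambda>r. q powr (1 - r)) \<longlongrightarrow> q powr (1 - 0)) (at_right 0)"
      using q0 by (intro tendsto_intros) auto
    then have "eventually (\<lambda>r. q powr (1 - r) < l) (at_right 0)"
      using q0 ql by (intro order_tendstoD(2)) auto
    moreover have "eventually (\<lambda>r::real. r \<in> {0<..<1}) (at_right 0)"
      by (rule eventually_at_right_real) simp
    ultimately have "eventually (\<lambda>r. q powr (1 - r) < l \<and> r \<in> {0<..<1}) (at_right 0)"
      by (rule eventually_conj)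
    then obtain r where r: "q powr (1 - r) < l" "0 < r" "r < 1"
      using eventually_happens[of _ "at_right (0::real)"] by auto
    \<comment> \<open>Here \<open>r_upper\<close> has the form \<open>t / t\<close>, which is 1 only
      for nonzero \<open>t\<close>.\<close>
    have "ln (1 / q) \<noteq> 0" using q0 ql l1 by (simp add: ln_div)
    then show ?thesis
      using True r l0
      by (intro exI[of _ 1] exI[of _ r])
         (simp only: r_lower_def r_upper_def rho_def rho_DM_def ratio inv, simp flip: l_def)
  next
    case False
    define Q where "Q = L + \<eta>"
    define g where "g = ln (1 / \<gamma>)"
    define a where "a = ln (Q / l)"
    \<comment> \<open>The solution of \<open>(1 - r) * a = r * g\<close>, the logarithmic form of
      \<open>\<gamma> powr r * Q powr (1 - r) = l powr (1 - r)\<close>.\<close>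
    define r where "r = a / (a + g)"
    have Q1: "1 \<le> Q" using assms by (simp add: Q_def)
    have \<gamma>0: "0 < \<gamma>" using False assms by simp
    have g0: "0 < g" using \<gamma>0 assms by (simp add: g_def)
    have lnl: "ln l < 0" using l0 l1 by simp
    have lnQ: "0 \<le> ln Q" using Q1 by simp
    have a_eq: "a = ln Q - ln l" using Q1 l0 by (simp add: a_def ln_div)
    then have a0: "0 < a" "ln Q < a" using lnQ lnl by auto
    have r1: "1 - r = g / (a + g)" using a0 g0 by (simp add: r_def field_simps)
    have r01: "0 < r" "r < 1" using a0 g0 by (simp_all add: r_def)
    have ratio: "(\<eta> * ((1/2) * (D - 2)) + 2 * ((1/2) * (L + \<eta> - 1)) + 1) / ((1/2) * (D - 2) + 1) = l"
      using lD D2 by (simp add: field_simps)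
    have inv: "((1/2) * (D - 2) + 1) / (\<eta> * ((1/2) * (D - 2)) + 2 * ((1/2) * (L + \<eta> - 1)) + 1) = 1 / l"
      unfolding ratio[symmetric] by simp
    have Qeq: "2 * ((1/2) * (L + \<eta> - 1)) + 1 = Q" by (simp add: Q_def field_simps)
    have ln\<gamma>: "ln \<gamma> = - g" using \<gamma>0 by (simp add: g_def ln_div)
    have "(1 - r) * (ln Q - ln l) = r * g"
      unfolding r1 unfolding r_def a_eq[symmetric] by simp
    then have "r * - g + (1 - r) * ln Q = (1 - r) * ln l"
      by (simp add: algebra_simps)
    then have bal: "\<gamma> powr r * Q powr (1 - r) = l powr (1 - r)"
      using \<gamma>0 Q1 l0 by (simp add: powr_def ln\<gamma> flip: exp_add)
    \<comment> \<open>Since \<open>J = D + 2 * L / l\<close>, the bound \<open>Q / l < J\<close>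
      amounts to \<open>Q < l * D + 2 * L\<close>.\<close>
    have "\<eta> < l * D + L"
      unfolding lD using mult_left_mono[of 1 D \<eta>] D2 assms \<open>0 < L\<close> by auto
    then have "Q < l * D + 2 * L"
      by (simp add: Q_def)
    then have QJ: "Q / l < J_DM \<eta> L \<delta>"
      using l0 by (simp add: J_DM_def flip: l_def D_def) (simp add: field_simps)
    then have aJ: "a < ln (J_DM \<eta> L \<delta>)"
      unfolding a_def using Q1 l0 by (subst ln_less_cancel_iff) (auto intro: less_trans[OF _ QJ])
    \<comment> \<open>The two decay exponents differ only in \<open>ln J\<close> against
      \<open>a\<close>.\<close>
    have "ln (1 / l) * g / (ln (J_DM \<eta> L \<delta>) + g) < ln (1 / l) * g / (a + g)"
      using aJ a0 g0 lnl l0 by (intro divide_strict_left_mono mult_pos_pos) (auto simp: ln_div)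
    also have "ln (1 / l) * g / (a + g) = - ((1 - r) * ln l)"
      unfolding r1 using l0 by (simp add: ln_div)
    finally have less: "l powr (1 - r) < rho_DM \<eta> L \<gamma> \<delta>"
      using False l0 by (simp add: rho_DM_def powr_def flip: l_def g_def)
    \<comment> \<open>The map \<open>t / (t + g)\<close> is increasing in \<open>t\<close>, and
      \<open>ln Q < a\<close>.\<close>
    have lower: "ln Q / (ln Q + g) < r"
      unfolding r_def using a0 g0 lnQ by (simp add: field_simps)
    have "ln (1 / l) \<noteq> 0" using lnl l0 by (simp add: ln_div)
    then show ?thesis
      using False r01 lower less bal
      by (intro exI[of _ "1/2"] exI[of _ r])
         (simp only: r_lower_def r_upper_def rho_def ratio inv Qeq, simp flip: g_def)
  qed
qed

theorem propositionA2:
  fixes P :: "'a::polish_space \<Rightarrow> 'a measure"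
    and Vbar :: "'a \<Rightarrow> real"
    and \<eta>' L' \<gamma>' \<delta>' :: real
  assumes "bounded (UNIV :: 'a set)"
    and "P \<in> borel \<rightarrow>\<^sub>M prob_algebra borel"
    and "cond_C1 P Vbar \<eta>' L'"
    and "cond_C2 P Vbar \<eta>' L' \<gamma>' \<delta>'"
  shows "\<exists>(V :: 'a \<Rightarrow> real) a L K \<eta> \<gamma> d.
      V \<in> borel_measurable borel \<and> (\<forall>x. 0 \<le> V x) \<and>
      0 \<le> a \<and> 0 \<le> L \<and> 0 \<le> K \<and> 0 \<le> \<eta> \<and> \<eta> < 1 \<and> 0 \<le> \<gamma> \<and> \<gamma> < 1 \<and> 2 * L / (1 - \<eta>) < d \<and>
      cond_A1 dist P V a \<eta> L \<and> cond_A2 dist P V d \<gamma> K \<and> cond_A3 \<eta> L d \<gamma> K \<and>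
      (\<exists>r. r_lower L \<gamma> < r \<and> r < r_upper \<eta> L d K \<and>
           rho \<eta> L d \<gamma> K r < rho_DM \<eta>' L' \<gamma>' \<delta>')"
proof -
  have meas: "Vbar \<in> borel_measurable borel" and V1: "\<And>x. 1 \<le> Vbar x"
    and \<eta>: "0 \<le> \<eta>'" "\<eta>' < 1" and drift: "drift P Vbar \<eta>' L'"
    using assms(3) by (auto simp: cond_C1_def)
  have \<gamma>: "0 \<le> \<gamma>'" "\<gamma>' < 1" and \<delta>: "0 < \<delta>'"
    using assms(4) by (auto simp: cond_C2_def)
  note prob = kernel_prob_space[OF assms(2)]
  have measP: "Vbar \<in> borel_measurable (P x)" for x
    using meas prob(2) measurable_cong_sets by blast
  have L: "1 - \<eta>' \<le> L'"
    using prob(1) drift V1 \<eta> by (rule drift_const_lower_bound)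
  define D where "D = (2 * L' + \<delta>') / (1 - \<eta>')"
  obtain c r where c: "0 < c" and r: "r_lower (c * (L' + \<eta>' - 1)) \<gamma>' < r"
    "r < r_upper \<eta>' (c * (L' + \<eta>' - 1)) (c * (D - 2)) 1"
    "rho \<eta>' (c * (L' + \<eta>' - 1)) (c * (D - 2)) \<gamma>' 1 r < rho_DM \<eta>' L' \<gamma>' \<delta>'"
    unfolding D_def using rho_one_lt_rho_DM[OF \<eta> L \<delta> \<gamma>] by blast
  define V where "V x = c * (Vbar x - 1)" for x
  have V0: "0 \<le> V x" for x using V1[of x] c by (simp add: V_def)
  \<comment> \<open>A bound on the diameter serves as \<open>a\<close>, because
    \<open>V x + V y + 1 \<ge> 1\<close>.\<close>
  obtain a where a: "\<And>x y::'a. dist x y \<le> a"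
    using assms(1) unfolding bounded_two_points by auto
  have a0: "0 \<le> a" using a[of undefined undefined] by simp
  have "dist x y \<le> a * (V x + V y + 1)" for x y
    using a[of x y] a0 V0[of x] V0[of y] mult_left_mono[of 1 "V x + V y + 1" a] by simp
  moreover have "drift P V \<eta>' (c * (L' + \<eta>' - 1))"
    using drift_affine[OF prob(1) measP drift V1] c by (simp add: V_def[abs_def])
  ultimately have A1: "cond_A1 dist P V a \<eta>' (c * (L' + \<eta>' - 1))"
    by (simp add: cond_A1_def)
  have A2: "cond_A2 dist P V (c * (D - 2)) \<gamma>' 1"
    using cond_A2_affine[OF assms(4) c] by (simp add: V_def[abs_def] D_def)
  \<comment> \<open>The right side exceeds the left by
    \<open>\<delta>' / (1 - \<eta>')\<close>.\<close>
  have "2 * (L' + \<eta>' - 1) / (1 - \<eta>') < D - 2"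
    using \<eta> \<delta> by (simp add: D_def field_simps)
  from mult_strict_left_mono[OF this c]
  have d: "2 * (c * (L' + \<eta>' - 1)) / (1 - \<eta>') < c * (D - 2)"
    by (simp add: mult_ac)
  have "V \<in> borel_measurable borel"
    unfolding V_def[abs_def] using meas by measurable
  moreover have "0 \<le> c * (L' + \<eta>' - 1)" using c L by simp
  moreover have "cond_A3 \<eta>' (c * (L' + \<eta>' - 1)) (c * (D - 2)) \<gamma>' 1"
    by (simp add: cond_A3_def)
  moreover have "(0::real) \<le> 1" by simp
  ultimately show ?thesis using V0 a0 \<eta> \<gamma> d A1 A2 r by blast
qed

end
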